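(* Consider a VRPSD instance with recourse costs $\mathcal{Q}_p$ satisfying the superadditivity property: $\mathcal{Q}_{(p_1,p_2)}\ge\mathcal{Q}_{p_1}+\mathcal{Q}_{p_2}$ for all $p_1,p_2\in\mathcal{P}$ with $(p_1,p_2)\in\mathcal{P}$. Then for every nonempty $S\subseteq N$, every $E_S\subseteq E(S)$, every integer $1\le m_{E_S}\le\bar m(E_S)$ and every real $0\le\mathcal{L}_{E_S}\le\bar{\mathcal{L}}(E_S,m_{E_S})$, the E-cut $$\sum_{i\in S}\theta_i\ge\mathcal{L}_{E_S}\left(\sum_{e\in E_S}x_e-|S|+m_{E_S}+1\right)$$ is valid.
   Context: **Instance.** Let $N=\{1,\dots,n\}$ be customers, $0$ the depot, $E$ the edge set of the complete undirected graph on $\{0\}\cup N$, with costs $c_e\ge 0$ satisfying the triangle inequality. For $S\subseteq N$, $E(S)$ is the set of edges with both endpoints in $S$. Customers have independent non-negative random demands with finite means $\mu_i$; $Q>0$ is the vehicle capacity, $f>0$ the load factor, $\max_i\mu_i\le fQ$. A set $M\subseteq\{1,\dots,n\}$ of admissible route counts is given. **Paths and recourse.** A path is a nonempty sequence $p=(i_1,\dots,i_t)$ of distinct customers, $N(p)$ its customer set, $\mathcal{P}=\{p:\sum_{i\in N(p)}\mu_i\le fQ\}$; $(p_1,p_2)$ denotes concatenation. A route-based recourse policy assigns to each path a finite cost $\bar{\mathcal{Q}}_p\ge0$, and $\mathcal{Q}_p$ is the minimum of $\bar{\mathcal{Q}}$ over $p$ and its reversal. **First stage.** A feasible first-stage solution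 is the edge-multiplicity vector $x\in\mathbb{Z}_{\ge 0}^E$ of a collection of $m\in M$ routes $(0,p_k,0)$ with $p_k\in\mathcal{P}$ and $\{N(p_k)\}_k$ a partition of $N$ (a single-customer route uses its depot edge twice). $\mathcal{P}(x)=\{p_1,\dots,p_m\}$ and $\mathcal{Q}(x)=\sum_{p\in\mathcal{P}(x)}\mathcal{Q}_p$. **DL-shaped model MP.** For $p=(i_1,\dots,i_t)$ let $p(x)=\sum_{j=1}^{t-1}x_{\{i_j,i_{j+1}\}}$. For nonempty $S\subseteq N$, $\Pi(S,m)$ is the set of all sets of $m$ feasible paths whose customer sets partition $S$, $m(S)=\min\{m:\Pi(S,m)\neq\emptyset\}$, $\mathcal{L}(S,m)=\min_{\pi\in\Pi(S,m)}\sum_{p\in\pi}\mathcal{Q}_p$. Given a collection $\mathcal{S}$ of nonempty subsets of $N$ and values $1\le m_S\le m(S)$, $0\le\mathcal{L}_S\le\mathcal{L}(S,m_S)$, MP minimizes $\sum_ec_ex_e+\sum_{i\in N}\theta_i$ over feasible first-stage $x$ and $\theta\in\mathbb{R}_{\ge0}^N$ subject to the P-cuts $\sum_{i\in N(p)}\theta_i\ge\mathcal{Q}_p(p(x)-|N(p)|+2)$ for all $p\in\mathcal{P}$ and the S-cuts $\sum_{i\in S}\theta_i\ge\mathcal{L}_S(\sum_{e\in E(S)}x_e-|S|+m_S+1)$ for all $S\in\mathcal{S}$. MP is a valid reformulation of the VRPSD if for every feasible first-stage $x$ the minimum of $\sum_i\theta_i$ over $\theta$ with $(x,\theta)$ feasible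 for MP equals $\mathcal{Q}(x)$. **Edge sets.** For $E_S\subseteq E(S)$, $\bar{\mathcal{P}}(E_S)\subseteq\mathcal{P}$ is the set of feasible paths in the graph $(S,E_S)$ (single-customer paths included); $\bar\Pi(E_S,m)=\{\pi\in\Pi(S,m):\pi\subseteq\bar{\mathcal{P}}(E_S)\}$; $\bar m(E_S)=\min\{m:\bar\Pi(E_S,m)\ne\emptyset\}$; $\bar{\mathcal{L}}(E_S,m)=\min_{\pi\in\bar\Pi(E_S,m)}\sum_{p\in\pi}\mathcal{Q}_p$. Minima over empty sets are $+\infty$. **Validity.** An inequality in $(x,\theta)$ is valid if MP is a valid reformulation of the VRPSD and every feasible solution $(x,\theta)$ of MP (with $x$ an integer feasible first-stage solution) satisfies the inequality. *)

theory Defs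
  imports "HOL-Probability.Probability"
begin

record 'w vrpsd =
  num_customers :: nat
  edge_cost :: "nat set \<Rightarrow> real"
  demand_space :: "'w measure"
  demand :: "nat \<Rightarrow> 'w \<Rightarrow> real"
  capacity :: real
  load_factor :: real
  route_counts :: "nat set"
  policy_cost :: "nat list \<Rightarrow> real"

definition customers :: "'w vrpsd \<Rightarrow> nat set" where
  "customers I = {1..num_customers I}"

definition complete_edges :: "nat set \<Rightarrow> nat set set" where
  "complete_edges V = {{u, v} | u v. u \<in> V \<and> v \<in> V \<and> u \<noteq> v}"

definition mean_demand :: "'w vrpsd \<Rightarrow> nat \<Rightarrow> real" where
  "mean_demand I i = (\<integral>\<omega>. demand I i \<omega> \<partial>demand_space I)"

definition is_path :: "'w vrpsd \<Rightarrow> nat list \<Rightarrow> bool" where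
  "is_path I p \<longleftrightarrow> p \<noteq> [] \<and> distinct p \<and> set p \<subseteq> customers I"

definition feasible_paths :: "'w vrpsd \<Rightarrow> nat list set" where
  "feasible_paths I =
     {p. is_path I p \<and> (\<Sum>i\<in>set p. mean_demand I i) \<le> load_factor I * capacity I}"

text \<open>Vertex \<open>0\<close> is the depot. The constraints on \<open>edge_cost\<close> and \<open>policy_cost\<close> concern only
  their values on edges and on paths; elsewhere these functions are arbitrary.\<close>

definition vrpsd_instance :: "'w vrpsd \<Rightarrow> bool" where
  "vrpsd_instance I \<longleftrightarrow>
     (\<forall>e\<in>complete_edges ({0} \<union> customers I). 0 \<le> edge_cost I e) \<and>
     (\<forall>u\<in>{0} \<union> customers I. \<forall>v\<in>{0} \<union> customers I. \<forall>w\<in>{0} \<union> customers I.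
        u \<noteq> v \<and> v \<noteq> w \<and> u \<noteq> w \<longrightarrow> edge_cost I {u, w} \<le> edge_cost I {u, v} + edge_cost I {v, w}) \<and>
     prob_space (demand_space I) \<and>
     prob_space.indep_vars (demand_space I) (\<lambda>_. borel) (demand I) (customers I) \<and>
     (\<forall>i\<in>customers I. (AE \<omega> in demand_space I. 0 \<le> demand I i \<omega>) \<and>
        integrable (demand_space I) (demand I i)) \<and>
     0 < capacity I \<and> 0 < load_factor I \<and>
     (\<forall>i\<in>customers I. mean_demand I i \<le> load_factor I * capacity I) \<and>
     route_counts I \<subseteq> {1..num_customers I} \<and>
     (\<forall>p. is_path I p \<longrightarrow> 0 \<le> policy_cost I p)"

definition recourse :: "'w vrpsd \<Rightarrow> nat list \<Rightarrow> real" where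
  "recourse I p = min (policy_cost I p) (policy_cost I (rev p))"

definition superadditive :: "'w vrpsd \<Rightarrow> bool" where
  "superadditive I \<longleftrightarrow>
     (\<forall>p1\<in>feasible_paths I. \<forall>p2\<in>feasible_paths I.
        p1 @ p2 \<in> feasible_paths I \<longrightarrow> recourse I p1 + recourse I p2 \<le> recourse I (p1 @ p2))"

definition walk_edges :: "nat list \<Rightarrow> nat set list" where
  "walk_edges p = map2 (\<lambda>u v. {u, v}) (butlast p) (tl p)"

definition path_partitions :: "'w vrpsd \<Rightarrow> nat set \<Rightarrow> nat \<Rightarrow> nat list set set" where
  "path_partitions I S m =
     {\<pi>. \<pi> \<subseteq> feasible_paths I \<and> card \<pi> = m \<and> inj_on set \<pi> \<and> partition_on S (set ` \<pi>)}"

definition route_plan :: "'w vrpsd \<Rightarrow> nat list set \<Rightarrow> bool" where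
  "route_plan I R \<longleftrightarrow> (\<exists>m\<in>route_counts I. R \<in> path_partitions I (customers I) m)"

text \<open>A single-customer path \<open>[i]\<close> yields the closed walk \<open>[0, i, 0]\<close>, so its depot edge counts
  twice.\<close>

definition edge_vector :: "nat list set \<Rightarrow> nat set \<Rightarrow> nat" where
  "edge_vector R e = (\<Sum>p\<in>R. count_list (walk_edges (0 # p @ [0])) e)"

definition first_stage :: "'w vrpsd \<Rightarrow> (nat set \<Rightarrow> nat) \<Rightarrow> bool" where
  "first_stage I x \<longleftrightarrow> (\<exists>R. route_plan I R \<and> x = edge_vector R)"

text \<open>The edge vector determines the paths of a plan up to reversal of individual paths, and
  \<open>recourse\<close> is invariant under reversal; hence \<open>total_recourse\<close> does not depend on the choice.\<close>

definition paths_of :: "'w vrpsd \<Rightarrow> (nat set \<Rightarrow> nat) \<Rightarrow> nat list set" where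
  "paths_of I x = (SOME R. route_plan I R \<and> x = edge_vector R)"

definition total_recourse :: "'w vrpsd \<Rightarrow> (nat set \<Rightarrow> nat) \<Rightarrow> real" where
  "total_recourse I x = (\<Sum>p\<in>paths_of I x. recourse I p)"

text \<open>The infima below range over finite sets, so they are minima; in \<open>enat\<close> and \<open>ereal\<close> the
  infimum of the empty set is \<open>\<infinity>\<close>.\<close>

definition min_paths :: "'w vrpsd \<Rightarrow> nat set \<Rightarrow> enat" where
  "min_paths I S = (INF m\<in>{m. path_partitions I S m \<noteq> {}}. enat m)"

definition min_recourse :: "'w vrpsd \<Rightarrow> nat set \<Rightarrow> nat \<Rightarrow> ereal" where
  "min_recourse I S m = (INF \<pi>\<in>path_partitions I S m. ereal (\<Sum>p\<in>\<pi>. recourse I p))"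

definition graph_paths :: "'w vrpsd \<Rightarrow> nat set \<Rightarrow> nat set set \<Rightarrow> nat list set" where
  "graph_paths I S F = {p \<in> feasible_paths I. set p \<subseteq> S \<and> set (walk_edges p) \<subseteq> F}"

definition graph_partitions :: "'w vrpsd \<Rightarrow> nat set \<Rightarrow> nat set set \<Rightarrow> nat \<Rightarrow> nat list set set" where
  "graph_partitions I S F m = {\<pi> \<in> path_partitions I S m. \<pi> \<subseteq> graph_paths I S F}"

definition graph_min_paths :: "'w vrpsd \<Rightarrow> nat set \<Rightarrow> nat set set \<Rightarrow> enat" where
  "graph_min_paths I S F = (INF m\<in>{m. graph_partitions I S F m \<noteq> {}}. enat m)"

definition graph_min_recourse :: "'w vrpsd \<Rightarrow> nat set \<Rightarrow> nat set set \<Rightarrow> nat \<Rightarrow> ereal" where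
  "graph_min_recourse I S F m = (INF \<pi>\<in>graph_partitions I S F m. ereal (\<Sum>p\<in>\<pi>. recourse I p))"

text \<open>The data of the S-cuts: the sets \<open>S\<close> and, for each of them, \<open>m\<^sub>S\<close> and \<open>L\<^sub>S\<close>.\<close>

record s_cut_data =
  cut_sets :: "nat set set"
  cut_count :: "nat set \<Rightarrow> nat"
  cut_bound :: "nat set \<Rightarrow> real"

definition admissible_cuts :: "'w vrpsd \<Rightarrow> s_cut_data \<Rightarrow> bool" where
  "admissible_cuts I D \<longleftrightarrow>
     (\<forall>S\<in>cut_sets D. S \<noteq> {} \<and> S \<subseteq> customers I \<and>
        1 \<le> cut_count D S \<and> enat (cut_count D S) \<le> min_paths I S \<and>
        0 \<le> cut_bound D S \<and> ereal (cut_bound D S) \<le> min_recourse I S (cut_count D S))"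

definition p_cut :: "'w vrpsd \<Rightarrow> nat list \<Rightarrow> (nat set \<Rightarrow> nat) \<Rightarrow> (nat \<Rightarrow> real) \<Rightarrow> bool" where
  "p_cut I p x \<theta> \<longleftrightarrow>
     (\<Sum>i\<in>set p. \<theta> i) \<ge>
       recourse I p * ((\<Sum>e\<leftarrow>walk_edges p. real (x e)) - real (card (set p)) + 2)"

definition s_cut :: "s_cut_data \<Rightarrow> nat set \<Rightarrow> (nat set \<Rightarrow> nat) \<Rightarrow> (nat \<Rightarrow> real) \<Rightarrow> bool" where
  "s_cut D S x \<theta> \<longleftrightarrow>
     (\<Sum>i\<in>S. \<theta> i) \<ge>
       cut_bound D S *
         ((\<Sum>e\<in>complete_edges S. real (x e)) - real (card S) + real (cut_count D S) + 1)"

definition mp_feasible ::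
  "'w vrpsd \<Rightarrow> s_cut_data \<Rightarrow> (nat set \<Rightarrow> nat) \<Rightarrow> (nat \<Rightarrow> real) \<Rightarrow> bool" where
  "mp_feasible I D x \<theta> \<longleftrightarrow>
     first_stage I x \<and> (\<forall>i\<in>customers I. 0 \<le> \<theta> i) \<and>
     (\<forall>p\<in>feasible_paths I. p_cut I p x \<theta>) \<and> (\<forall>S\<in>cut_sets D. s_cut D S x \<theta>)"

text \<open>The two conjuncts say that \<open>total_recourse I x\<close> is the (attained) minimum of the sums
  of \<open>\<theta>\<close>.\<close>

definition mp_valid :: "'w vrpsd \<Rightarrow> s_cut_data \<Rightarrow> bool" where
  "mp_valid I D \<longleftrightarrow>
     (\<forall>x. first_stage I x \<longrightarrow>
        (\<exists>\<theta>. mp_feasible I D x \<theta> \<and> (\<Sum>i\<in>customers I. \<theta> i) = total_recourse I x) \<and>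
        (\<forall>\<theta>. mp_feasible I D x \<theta> \<longrightarrow> total_recourse I x \<le> (\<Sum>i\<in>customers I. \<theta> i)))"

definition valid_inequality ::
  "'w vrpsd \<Rightarrow> s_cut_data \<Rightarrow> ((nat set \<Rightarrow> nat) \<Rightarrow> (nat \<Rightarrow> real) \<Rightarrow> bool) \<Rightarrow> bool" where
  "valid_inequality I D ineq \<longleftrightarrow>
     mp_valid I D \<and> (\<forall>x \<theta>. mp_feasible I D x \<theta> \<longrightarrow> ineq x \<theta>)"

end

theory Submission
  imports Defs
begin

text \<open>
  Restricting the routes of a plan \<open>x\<close> to the graph \<open>(S, E\<^sub>S)\<close> cuts them into \<open>k = |S| - \<Sum>e\<in>E\<^sub>S. x e\<close>
  feasible paths, so \<open>m \<le> k\<close>. If \<open>m < k\<close>, the right-hand side of the E-cut is at most \<open>0\<close>; if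
  \<open>m = k\<close>, it equals \<open>L\<close>, and adding the P-cuts of these \<open>k\<close> paths bounds \<open>\<Sum>i\<in>S. \<theta> i\<close> from below by
  their total recourse, hence by \<open>L\<close>. An S-cut is the case where \<open>E\<^sub>S\<close> consists of all edges in \<open>S\<close>.

  For the validity of MP, the P-cuts of the routes give the lower bound. A solution attaining it
  gives each customer the increase of the recourse cost from the prefix of its route before it to
  the prefix ending in it: the sum over a contiguous part of a route telescopes, and
  superadditivity makes it dominate the recourse of that part. The P-cuts of all other paths are
  trivial.
\<close>

section \<open>Edges traversed by a path\<close>

lemma walk_edges_simps [simp]:
  "walk_edges [] = []" "walk_edges [v] = []"
  "walk_edges (v # w # p) = {v, w} # walk_edges (w # p)"
  by (simp_all add: walk_edges_def)

lemma length_walk_edges [simp]: "length (walk_edges p) = length p - 1"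
  by (simp add: walk_edges_def)

lemma walk_edges_append:
  "p \<noteq> [] \<Longrightarrow> q \<noteq> [] \<Longrightarrow>
     walk_edges (p @ q) = walk_edges p @ {last p, hd q} # walk_edges q"
proof (induction p)
  case (Cons v p)
  then show ?case
    by (cases p; cases q) auto
qed simp

lemma walk_edges_rev: "walk_edges (rev p) = rev (walk_edges p)"
proof (induction p)
  case (Cons v p)
  then show ?case
    using walk_edges_append[of "rev p" "[v]"]
    by (cases "p = []") (auto simp: insert_commute last_rev walk_edges_append[of "[v]" p, simplified])
qed simp

lemma in_walk_edges_subset: "e \<in> set (walk_edges p) \<Longrightarrow> e \<subseteq> set p"
  by (induction p rule: induct_list012) auto

text \<open>The first edge contains the head of the path, which lies on no later edge because
  vertices do not repeat.\<close>

lemma distinct_walk_edges: "distinct p \<Longrightarrow> distinct (walk_edges p)"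
  by (induction p rule: induct_list012) (auto dest: in_walk_edges_subset)

lemma complete_edges_mono: "V \<subseteq> W \<Longrightarrow> complete_edges V \<subseteq> complete_edges W"
  unfolding complete_edges_def by blast

lemma walk_edges_in_complete: "distinct p \<Longrightarrow> set (walk_edges p) \<subseteq> complete_edges (set p)"
proof (induction p rule: induct_list012)
  case (3 v w p)
  have "complete_edges (set (w # p)) \<subseteq> complete_edges (set (v # w # p))"
    by (intro complete_edges_mono) auto
  moreover have "{v, w} \<in> complete_edges (set (v # w # p))"
    using 3 by (auto simp: complete_edges_def)
  ultimately show ?case using 3 by auto
qed auto

text \<open>Recovers the direction in which an undirected edge is traversed, so that its position in
  the list can be compared with other decompositions of that list.\<close>

lemma in_walk_edges_split:
  "e \<in> set (walk_edges p) \<Longrightarrow> \<exists>a v w b. p = a @ [v, w] @ b \<and> e = {v, w}"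
proof (induction p rule: induct_list012)
  case (3 v w p)
  show ?case
  proof (cases "e = {v, w}")
    case True
    then have "v # w # p = [] @ [v, w] @ p \<and> e = {v, w}" by simp
    then show ?thesis by blast
  next
    case False
    then have "e \<in> set (walk_edges (w # p))" using 3(3) by simp
    then obtain a v' w' b where "w # p = a @ [v', w'] @ b" "e = {v', w'}"
      using 3(2) by blast
    then have "v # w # p = (v # a) @ [v', w'] @ b \<and> e = {v', w'}" by simp
    then show ?thesis by blast
  qed
qed auto

lemma finite_complete_edges: "finite V \<Longrightarrow> finite (complete_edges V)"
  by (rule finite_subset[of _ "Pow V"]) (auto simp: complete_edges_def)

lemma count_list_distinct: "distinct xs \<Longrightarrow> count_list xs x = of_bool (x \<in> set xs)"
  by (induction xs) auto

section \<open>Cutting a path along an edge set\<close>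

text \<open>The segments are the components of \<open>p\<close> restricted to the graph \<open>(S, F)\<close>. The last
  conjunct makes the induction work: it locates the segment to be extended by a new head.\<close>

lemma exists_segmentation:
  assumes "distinct p" "F \<subseteq> complete_edges S"
  shows "\<exists>qs. concat qs = filter (\<lambda>v. v \<in> S) p \<and> [] \<notin> set qs \<and>
           (\<forall>q\<in>set qs. set (walk_edges q) \<subseteq> F \<inter> set (walk_edges p)) \<and>
           length qs + card (F \<inter> set (walk_edges p)) = card (S \<inter> set p) \<and>
           (p \<noteq> [] \<and> hd p \<in> S \<longrightarrow> qs \<noteq> [] \<and> hd (hd qs) = hd p)"
  using assms(1)
proof (induction p rule: induct_list012)
  case 1
  show ?case by (intro exI[of _ "[]"]) auto
next
  case (2 v)
  show ?case by (intro exI[of _ "if v \<in> S then [[v]] else []"]) auto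
next
  case (3 v w p)
  then obtain qs where qs:
    "concat qs = filter (\<lambda>v. v \<in> S) (w # p)" "[] \<notin> set qs"
    "\<forall>q\<in>set qs. set (walk_edges q) \<subseteq> F \<inter> set (walk_edges (w # p))"
    "length qs + card (F \<inter> set (walk_edges (w # p))) = card (S \<inter> set (w # p))"
    "w \<in> S \<longrightarrow> qs \<noteq> [] \<and> hd (hd qs) = w"
    by auto
  let ?W = "set (walk_edges (w # p))"
  \<comment> \<open>No edge of the tail contains \<open>v\<close>, so the edge count rises by
    exactly one if \<open>{v, w}\<close> lies in \<open>F\<close>.\<close>
  have new: "{v, w} \<notin> ?W"
    using 3(3) by (auto dest!: in_walk_edges_subset)
  have cS: "card (S \<inter> set (v # w # p)) = of_bool (v \<in> S) + card (S \<inter> set (w # p))"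
    using 3(3) by (auto simp: Int_insert_right)
  have cF: "card (F \<inter> set (walk_edges (v # w # p))) = of_bool ({v, w} \<in> F) + card (F \<inter> ?W)"
    using new by (auto simp: Int_insert_right)
  have ends: "v \<in> S \<and> w \<in> S" if "{v, w} \<in> F"
    using that assms(2) by (force simp: complete_edges_def doubleton_eq_iff)
  \<comment> \<open>If the edge lies in \<open>F\<close>, both ends lie in \<open>S\<close>, so
    \<open>w\<close> heads the first segment and \<open>v\<close> is prepended to it: one more
    vertex, one more edge, equally many segments. Otherwise \<open>v\<close> in \<open>S\<close>
    becomes a segment of its own, and \<open>v\<close> outside \<open>S\<close> changes
    nothing.\<close>
  consider "{v, w} \<in> F" | "{v, w} \<notin> F" "v \<in> S" | "{v, w} \<notin> F" "v \<notin> S"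
    by blast
  then show ?case
  proof cases
    case 1
    then have vw: "v \<in> S" "w \<in> S" using ends by auto
    then obtain q qs' where q: "qs = q # qs'" using qs(5) by (cases qs) auto
    with qs(2,5) vw obtain q' where q': "q = w # q'" by (cases q) auto
    show ?thesis
      using qs cS cF 1 vw unfolding q q'
      by (intro exI[of _ "(v # w # q') # qs'"]) auto
  next
    case 2
    then show ?thesis
      using qs cS cF by (intro exI[of _ "[v] # qs"]) auto
  next
    case 3
    then show ?thesis
      using qs cS cF by (intro exI[of _ qs]) auto
  qed
qed

text \<open>Passes from a list of segments to the set form used in \<open>path_partitions\<close>.
  Nonempty segments without common vertices have different vertex sets, so no segment is lost in
  counting.\<close>

lemma path_family_of_lists:
  assumes "distinct (concat qs)" "[] \<notin> set qs"
  shows "distinct qs" "inj_on set (set qs)" "partition_on (set (concat qs)) (set ` set qs)"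
proof -
  have "distinct qs \<and> inj_on set (set qs) \<and> partition_on (set (concat qs)) (set ` set qs)"
    using assms
  proof (induction qs)
    case Nil
    then show ?case by (simp add: partition_on_empty)
  next
    case (Cons q qs)
    have disj: "set q \<inter> set (concat qs) = {}" and "q \<noteq> []" using Cons.prems by auto
    then have nin: "set q \<notin> set ` set qs" by (cases q) auto
    have "partition_on (set q \<union> set (concat qs)) (insert (set q) (set ` set qs))"
    proof (subst partition_on_insert)
      show "disjnt (set q) (\<Union> (set ` set qs))" using disj by (auto simp: disjnt_def)
      have "set q \<union> set (concat qs) - set q = set (concat qs)" using disj by auto
      then show "partition_on (set q \<union> set (concat qs) - set q) (set ` set qs) \<and>
          set q \<subseteq> set q \<union> set (concat qs) \<and> set q \<noteq> {}"
        using Cons \<open>q \<noteq> []\<close> by auto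
    qed
    then show ?case using Cons nin by auto
  qed
  then show "distinct qs" "inj_on set (set qs)"
    "partition_on (set (concat qs)) (set ` set qs)" by auto
qed

section \<open>Feasible paths and route plans\<close>

lemma mean_demand_nonneg:
  assumes "vrpsd_instance I" "i \<in> customers I"
  shows "0 \<le> mean_demand I i"
  using assms unfolding mean_demand_def vrpsd_instance_def
  by (intro integral_nonneg_AE) auto

lemma finite_customers [simp]: "finite (customers I)"
  by (simp add: customers_def)

text \<open>Means are non-negative, so omitting customers cannot increase the load, and the load
  ignores their order. This covers segments, prefixes and single customers of a route.\<close>

lemma feasible_paths_mono:
  assumes "vrpsd_instance I" "p \<in> feasible_paths I"
    and "q \<noteq> []" "distinct q" "set q \<subseteq> set p"
  shows "q \<in> feasible_paths I"
proof -
  have "(\<Sum>i\<in>set q. mean_demand I i) \<le> (\<Sum>i\<in>set p. mean_demand I i)"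
    using assms by (intro sum_mono2)
      (auto simp: feasible_paths_def is_path_def intro!: mean_demand_nonneg)
  then show ?thesis
    using assms by (auto simp: feasible_paths_def is_path_def)
qed

lemma recourse_nonneg:
  "vrpsd_instance I \<Longrightarrow> p \<in> feasible_paths I \<Longrightarrow> 0 \<le> recourse I p"
  by (auto simp: vrpsd_instance_def feasible_paths_def recourse_def is_path_def)

lemma recourse_rev [simp]: "recourse I (rev p) = recourse I p"
  by (simp add: recourse_def min.commute)

lemma route_planD:
  assumes "route_plan I R"
  shows "finite R" "\<And>p. p \<in> R \<Longrightarrow> p \<in> feasible_paths I" "(\<Union>p\<in>R. set p) = customers I"
    "\<And>p q. p \<in> R \<Longrightarrow> q \<in> R \<Longrightarrow> p \<noteq> q \<Longrightarrow> set p \<inter> set q = {}"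
    "\<And>p. p \<in> R \<Longrightarrow> distinct p" "\<And>p. p \<in> R \<Longrightarrow> p \<noteq> []"
proof -
  have R: "R \<subseteq> feasible_paths I" "inj_on set R" "partition_on (customers I) (set ` R)"
    using assms by (auto simp: route_plan_def path_partitions_def)
  show "finite R"
    using R finite_elements[OF finite_customers R(3)] finite_image_iff by blast
  show "\<And>p. p \<in> R \<Longrightarrow> p \<in> feasible_paths I" using R by auto
  show "(\<Union>p\<in>R. set p) = customers I" using R(3) by (auto simp: partition_on_def)
  \<comment> \<open>Injectivity of \<open>set\<close> on \<open>R\<close> excludes two different
    paths on the same customers, such as a path and its reversal; the partition of the images alone
    would allow them.\<close>
  show "\<And>p q. p \<in> R \<Longrightarrow> q \<in> R \<Longrightarrow> p \<noteq> q \<Longrightarrow> set p \<inter> set q = {}"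
    using R(2,3) unfolding partition_on_def disjoint_def inj_on_def
    by (metis image_eqI)
  show "\<And>p. p \<in> R \<Longrightarrow> distinct p" "\<And>p. p \<in> R \<Longrightarrow> p \<noteq> []"
    using R by (auto simp: feasible_paths_def is_path_def)
qed

section \<open>Edge vectors of route plans\<close>

text \<open>The closed walk adds to a path only its two depot edges, which
  \<open>0 \<notin> e\<close> excludes; every other edge is traversed at most once since the
  customers of a path are distinct.\<close>

lemma edge_vector_eq:
  assumes "route_plan I R" "0 \<notin> e"
  shows "edge_vector R e = (\<Sum>p\<in>R. of_bool (e \<in> set (walk_edges p)))"
  unfolding edge_vector_def
proof (rule sum.cong)
  fix p assume "p \<in> R"
  then have p: "p \<noteq> []" "distinct p" using route_planD[OF assms(1)] by auto
  have "walk_edges (0 # p @ [0]) = {0, hd p} # walk_edges p @ [{last p, 0}]"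
    using p walk_edges_append[of "[0]" "p @ [0]"] walk_edges_append[of p "[0]"] by simp
  then show "count_list (walk_edges (0 # p @ [0])) e = of_bool (e \<in> set (walk_edges p))"
    using assms(2) count_list_distinct[OF distinct_walk_edges[OF p(2)], of e] by auto
qed simp

lemma complete_edges_no_depot: "S \<subseteq> customers I \<Longrightarrow> e \<in> complete_edges S \<Longrightarrow> 0 \<notin> e"
  by (auto simp: complete_edges_def customers_def)

text \<open>Double counting of the pairs of an edge in \<open>F\<close> and a route traversing
  it.\<close>

lemma sum_edge_vector:
  assumes R: "route_plan I R" and "S \<subseteq> customers I" "F \<subseteq> complete_edges S"
  shows "(\<Sum>e\<in>F. edge_vector R e) = (\<Sum>p\<in>R. card (F \<inter> set (walk_edges p)))"
proof -
  have "finite F"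
    using assms finite_complete_edges finite_customers finite_subset by metis
  have "(\<Sum>e\<in>F. edge_vector R e) = (\<Sum>e\<in>F. \<Sum>p\<in>R. of_bool (e \<in> set (walk_edges p)))"
    using assms(3) complete_edges_no_depot[OF assms(2)]
    by (intro sum.cong edge_vector_eq[OF R]) auto
  also have "\<dots> = (\<Sum>p\<in>R. \<Sum>e\<in>F. of_bool (e \<in> set (walk_edges p)))"
    by (rule sum.swap)
  also have "\<dots> = (\<Sum>p\<in>R. card (F \<inter> set (walk_edges p)))"
    using \<open>finite F\<close> by (intro sum.cong) (auto simp: of_bool_def sum.If_cases Int_def)
  finally show ?thesis .
qed

text \<open>Two routes traversing the same edge would share its endpoints, but the routes of a plan
  are vertex-disjoint.\<close>

lemma edge_vector_route_edge:
  assumes R: "route_plan I R" and p: "p \<in> R" and e: "e \<in> set (walk_edges p)"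
  shows "edge_vector R e = 1"
proof -
  have pd: "distinct p" "set p \<subseteq> customers I" using route_planD[OF R] p by auto
  have ec: "e \<in> complete_edges (set p)" using walk_edges_in_complete[OF pd(1)] e by auto
  then have "0 \<notin> e" using complete_edges_no_depot pd by metis
  have "e \<in> set (walk_edges q) \<longleftrightarrow> q = p" if "q \<in> R" for q
  proof -
    have "e \<noteq> {}" using ec by (auto simp: complete_edges_def)
    then show ?thesis
      using route_planD(4)[OF R that p] in_walk_edges_subset[OF e] in_walk_edges_subset[of e q] e
      by blast
  qed
  then have "edge_vector R e = (\<Sum>q\<in>R. of_bool (q = p))"
    unfolding edge_vector_eq[OF R \<open>0 \<notin> e\<close>] by (intro sum.cong) auto
  also have "\<dots> = 1" using route_planD(1)[OF R] p by (simp add: of_bool_def)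
  finally show ?thesis .
qed

lemma edge_vector_nonroute_edge:
  assumes "route_plan I R" "0 \<notin> e" "\<And>p. p \<in> R \<Longrightarrow> e \<notin> set (walk_edges p)"
  shows "edge_vector R e = 0"
  using assms by (simp add: edge_vector_eq)

section \<open>Cutting a whole plan along an edge set\<close>

text \<open>Each route is cut separately, and the counts of segments, edges and vertices are summed
  over the routes. The identity is stated additively to avoid truncated subtraction. The last fact
  holds because edges of segments are edges of routes; it makes the P-cuts of the segments
  effective.\<close>

lemma plan_segmentation:
  assumes I: "vrpsd_instance I" and R: "route_plan I R"
    and S: "S \<subseteq> customers I" and F: "F \<subseteq> complete_edges S"
  obtains k \<pi> where "\<pi> \<in> graph_partitions I S F k" "finite \<pi>"
    "k + (\<Sum>e\<in>F. edge_vector R e) = card S"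
    "\<And>q e. q \<in> \<pi> \<Longrightarrow> e \<in> set (walk_edges q) \<Longrightarrow> edge_vector R e = 1"
proof -
  note RD = route_planD[OF R]
  have "\<forall>p\<in>R. \<exists>qs. concat qs = filter (\<lambda>v. v \<in> S) p \<and> [] \<notin> set qs \<and>
           (\<forall>q\<in>set qs. set (walk_edges q) \<subseteq> F \<inter> set (walk_edges p)) \<and>
           length qs + card (F \<inter> set (walk_edges p)) = card (S \<inter> set p)"
    using exists_segmentation[OF RD(5) F] by blast
  then obtain g where g: "\<forall>p\<in>R. concat (g p) = filter (\<lambda>v. v \<in> S) p \<and> [] \<notin> set (g p) \<and>
           (\<forall>q\<in>set (g p). set (walk_edges q) \<subseteq> F \<inter> set (walk_edges p)) \<and>
           length (g p) + card (F \<inter> set (walk_edges p)) = card (S \<inter> set p)"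
    by metis
  obtain rs where rs: "set rs = R" "distinct rs"
    using finite_distinct_list[OF RD(1)] by blast
  define qs where "qs = concat (map g rs)"
  \<comment> \<open>Joining all segments gives the joined routes with the customers outside
    \<open>S\<close> removed. Distinctness and the vertex set \<open>S\<close> of the family are
    read off from this. The induction needs the claim for every list of routes from
    \<open>R\<close>.\<close>
  have cq: "concat qs = filter (\<lambda>v. v \<in> S) (concat rs)"
  proof -
    have "concat (concat (map g rs')) = filter (\<lambda>v. v \<in> S) (concat rs')"
      if "set rs' \<subseteq> R" for rs'
      using that g by (induction rs') auto
    then show ?thesis using rs by (simp add: qs_def)
  qed
  have "distinct (concat rs)"
    using rs RD by (intro distinct_concat) auto
  then have dist: "distinct (concat qs)" by (simp add: cq)
  have ne: "[] \<notin> set qs" using g rs by (auto simp: qs_def)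
  note fam = path_family_of_lists[OF dist ne]
  have setS: "set (concat qs) = S"
    unfolding cq using rs(1) RD(3) S by auto
  have seg: "\<exists>p\<in>R. set (walk_edges q) \<subseteq> F \<inter> set (walk_edges p) \<and> q \<in> feasible_paths I \<and> set q \<subseteq> S"
    if q: "q \<in> set qs" for q
  proof -
    obtain p where p: "p \<in> R" "q \<in> set (g p)" using q rs by (auto simp: qs_def)
    have "set q \<subseteq> set (concat (g p))" using p by auto
    also have "\<dots> = set p \<inter> S" using g p by auto
    finally have sub: "set q \<subseteq> set p \<inter> S" .
    have "distinct q" using dist q by (auto simp: distinct_concat_iff)
    moreover have "q \<noteq> []" using ne q by auto
    ultimately have "q \<in> feasible_paths I"
      using feasible_paths_mono[OF I RD(2)[OF p(1)]] sub by blast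
    then show ?thesis using g p sub by blast
  qed
  show ?thesis
  proof
    show "set qs \<in> graph_partitions I S F (length qs)"
      using fam(1,2) fam(3)[unfolded setS] seg by (auto simp: graph_partitions_def path_partitions_def graph_paths_def
          distinct_card)
    show "edge_vector R e = 1" if "q \<in> set qs" "e \<in> set (walk_edges q)" for q e
      using seg[OF that(1)] that(2) edge_vector_route_edge[OF R] by blast
    have "length qs = (\<Sum>p\<in>R. length (g p))"
      unfolding qs_def length_concat using rs
      by (simp add: sum_list_distinct_conv_sum_set o_def)
    then have "length qs + (\<Sum>e\<in>F. edge_vector R e) =
        (\<Sum>p\<in>R. length (g p) + card (F \<inter> set (walk_edges p)))"
      by (simp add: sum_edge_vector[OF R S F] sum.distrib)
    also have "\<dots> = (\<Sum>p\<in>R. card (S \<inter> set p))"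
      using g by (intro sum.cong) auto
    also have "\<dots> = card (\<Union>p\<in>R. S \<inter> set p)"
      using RD(1,4) by (intro card_UN_disjoint[symmetric]) fastforce+
    also have "(\<Union>p\<in>R. S \<inter> set p) = S" using RD(3) S by auto
    finally show "length qs + (\<Sum>e\<in>F. edge_vector R e) = card S" .
  qed simp
qed

section \<open>E-cuts and S-cuts as consequences of the P-cuts\<close>

text \<open>A path on \<open>t\<close> customers has \<open>t - 1\<close> edges, each of value 1, so
  the bracket of the P-cut is \<open>(t - 1) - t + 2 = 1\<close>.\<close>

lemma p_cut_traversed:
  assumes "p_cut I p x \<theta>" "distinct p" "p \<noteq> []" "\<And>e. e \<in> set (walk_edges p) \<Longrightarrow> x e = 1"
  shows "recourse I p \<le> (\<Sum>i\<in>set p. \<theta> i)"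
proof -
  have "(\<Sum>e\<leftarrow>walk_edges p. real (x e)) = (\<Sum>e\<leftarrow>walk_edges p. 1)"
    using assms(4) by (intro arg_cong[of _ _ sum_list]) simp
  also have "\<dots> = real (length p) - 1"
    using assms(3) by (cases p) (auto simp: sum_list_triv)
  finally show ?thesis
    using assms(1,2) by (simp add: p_cut_def distinct_card)
qed

text \<open>Assumes the P-cuts and \<open>\<theta> \<ge> 0\<close> in place of
  \<open>mp_feasible\<close>, because the S-cuts are derived from it when a solution is shown to be
  feasible for MP.\<close>

lemma e_cut_holds:
  assumes I: "vrpsd_instance I" and x: "first_stage I x"
    and \<theta>: "\<forall>i\<in>customers I. 0 \<le> \<theta> i" and P: "\<forall>p\<in>feasible_paths I. p_cut I p x \<theta>"
    and S: "S \<subseteq> customers I" and F: "F \<subseteq> complete_edges S"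
    and m: "enat m \<le> graph_min_paths I S F"
    and L: "0 \<le> L" "ereal L \<le> graph_min_recourse I S F m"
  shows "L * ((\<Sum>e\<in>F. real (x e)) - real (card S) + real m + 1) \<le> (\<Sum>i\<in>S. \<theta> i)"
proof -
  obtain R where R: "route_plan I R" and xR: "x = edge_vector R"
    using x by (auto simp: first_stage_def)
  obtain k \<pi> where \<pi>: "\<pi> \<in> graph_partitions I S F k" "finite \<pi>"
    and k: "k + (\<Sum>e\<in>F. x e) = card S"
    and one: "\<And>q e. q \<in> \<pi> \<Longrightarrow> e \<in> set (walk_edges q) \<Longrightarrow> x e = 1"
    using plan_segmentation[OF I R S F] unfolding xR by metis
  \<comment> \<open>The bracket of the E-cut thus equals \<open>m - k + 1\<close>: it is 1 for
    \<open>k = m\<close> and at most 0 for larger \<open>k\<close>.\<close>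
  have eq: "(\<Sum>e\<in>F. real (x e)) - real (card S) = - real k"
    using k by (simp flip: of_nat_sum k)
  have nonneg: "0 \<le> (\<Sum>i\<in>S. \<theta> i)" using \<theta> S by (intro sum_nonneg) auto
  have "enat m \<le> enat k"
    using m \<pi> unfolding graph_min_paths_def by (blast intro: INF_lower2 order.trans INF_lower)
  then consider "k = m" | "m + 1 \<le> k" by fastforce
  then show ?thesis
  proof cases
    case 1
    have part: "partition_on S (set ` \<pi>)" "inj_on set \<pi>" "\<pi> \<subseteq> feasible_paths I"
      using \<pi> by (auto simp: graph_partitions_def path_partitions_def)
    have "ereal L \<le> ereal (\<Sum>p\<in>\<pi>. recourse I p)"
      using L(2) \<pi>(1) 1 unfolding graph_min_recourse_def by (blast intro: order.trans INF_lower)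
    then have "L \<le> (\<Sum>p\<in>\<pi>. recourse I p)" by simp
    also have "\<dots> \<le> (\<Sum>p\<in>\<pi>. \<Sum>i\<in>set p. \<theta> i)"
    proof (rule sum_mono)
      fix p assume p: "p \<in> \<pi>"
      then have fp: "p \<in> feasible_paths I" "p \<noteq> []" "distinct p"
        using part by (auto simp: feasible_paths_def is_path_def)
      then show "recourse I p \<le> (\<Sum>i\<in>set p. \<theta> i)"
        using P one[OF p] p_cut_traversed[of I p x \<theta>] by blast
    qed
    also have "\<dots> = (\<Sum>i\<in>(\<Union>p\<in>\<pi>. set p). \<theta> i)"
    proof (rule sum.UNION_disjoint[symmetric])
      show "\<forall>p\<in>\<pi>. \<forall>q\<in>\<pi>. p \<noteq> q \<longrightarrow> set p \<inter> set q = {}"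
        using part(1,2) unfolding partition_on_def disjoint_def inj_on_def by (metis image_eqI)
    qed (use \<pi>(2) in auto)
    also have "(\<Union>p\<in>\<pi>. set p) = S" using part(1) by (auto simp: partition_on_def)
    finally show ?thesis by (simp add: eq 1)
  next
    case 2
    then have "L * ((\<Sum>e\<in>F. real (x e)) - real (card S) + real m + 1) \<le> 0"
      using L(1) by (intro mult_nonneg_nonpos) (auto simp: eq)
    then show ?thesis using nonneg by simp
  qed
qed

lemma graph_partitions_complete:
  "graph_partitions I S (complete_edges S) m = path_partitions I S m"
proof -
  have "set (walk_edges p) \<subseteq> complete_edges S"
    if "p \<in> feasible_paths I" "set p \<subseteq> S" for p
    using walk_edges_in_complete[of p] complete_edges_mono[OF that(2)] that(1)
    unfolding feasible_paths_def is_path_def by blast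
  then show ?thesis
    unfolding graph_partitions_def path_partitions_def graph_paths_def partition_on_def by blast
qed

lemma s_cut_holds:
  assumes "vrpsd_instance I" "first_stage I x" "\<forall>i\<in>customers I. 0 \<le> \<theta> i"
    and "\<forall>p\<in>feasible_paths I. p_cut I p x \<theta>" "admissible_cuts I D" "S \<in> cut_sets D"
  shows "s_cut D S x \<theta>"
  using assms e_cut_holds[of I x \<theta> S "complete_edges S" "cut_count D S" "cut_bound D S"]
  unfolding s_cut_def admissible_cuts_def graph_min_paths_def graph_min_recourse_def
    graph_partitions_complete min_paths_def min_recourse_def
  by auto

section \<open>Paths that use only route edges\<close>

lemma distinct_split_unique:
  assumes "distinct (a @ v # b)" "a @ v # b = c @ v # d"
  shows "a = c" "b = d"
proof -
  have "v \<notin> set a" "v \<notin> set b" using assms(1) by auto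
  then have "a = c \<and> b = d"
    using assms(2) append_Cons_eq_iff[of v a b c d] by simp
  then show "a = c" "b = d" by auto
qed

text \<open>The tail of \<open>p\<close> forms a block of \<open>r\<close> by induction, and the new
  vertex \<open>v\<close> is a neighbour of its end \<open>w\<close>. On the inner side of
  \<open>w\<close> the neighbour already belongs to the block, unless the block is just
  \<open>w\<close>, so \<open>v\<close> extends the block outwards. The condition on
  \<open>hd p\<close> places a single vertex, which has no edges.\<close>

lemma contiguous_of_walk_edges:
  assumes "p \<noteq> []" "distinct p" "distinct r" "hd p \<in> set r"
    and "set (walk_edges p) \<subseteq> set (walk_edges r)"
  shows "\<exists>a b. r = a @ p @ b \<or> r = a @ rev p @ b"
  using assms
proof (induction p rule: induct_list012)
  case (2 v)
  then show ?case by (auto dest: split_list)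
next
  case (3 v w p)
  \<comment> \<open>Stated for an arbitrary list \<open>r'\<close> in order to serve both
    \<open>r\<close> and \<open>rev r\<close>.\<close>
  have step: "\<exists>a b. r' = a @ (v # w # p) @ b \<or> r' = a @ rev (v # w # p) @ b"
    if r': "distinct r'" "{v, w} \<in> set (walk_edges r')" "r' = a @ (w # p) @ b" for r' a b
  proof -
    obtain c s t d where cd: "r' = c @ [s, t] @ d" "{v, w} = {s, t}"
      using in_walk_edges_split[OF r'(2)] by metis
    then consider "r' = (c @ [v]) @ w # d" | "r' = c @ w # v # d"
      by (auto simp: doubleton_eq_iff)
    then show ?thesis
    proof cases
      case 1
      then have "a = c @ [v]"
        using distinct_split_unique(1)[of a w "p @ b" "c @ [v]" d] r' by simp
      then show ?thesis using r' by (metis append_Cons append_Nil append_assoc)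
    next
      case 2
      then have "p @ b = v # d"
        using distinct_split_unique(2)[of a w "p @ b" c "v # d"] r' by simp
      \<comment> \<open>Here \<open>v\<close> follows \<open>w\<close> in \<open>r'\<close>, and so
        does \<open>p\<close>. Since \<open>v\<close> does not occur in \<open>p\<close>, the block
        is only \<open>w\<close>, and \<open>[w, v]\<close> is the reversed path.\<close>
      then have "p = []" using 3(4) by (cases p) auto
      then show ?thesis using 2 by (metis append_Cons append_Nil rev.simps)
    qed
  qed
  have e: "{v, w} \<in> set (walk_edges r)" using 3 by auto
  then have "w \<in> set r" by (auto dest: in_walk_edges_subset)
  then obtain a b where "r = a @ (w # p) @ b \<or> r = a @ rev (w # p) @ b"
    using 3 by auto
  then show ?case
  proof
    assume "r = a @ (w # p) @ b"
    then show ?thesis using step[of r a b] e 3 by blast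
  next
    assume "r = a @ rev (w # p) @ b"
    \<comment> \<open>A block running backwards in \<open>r\<close> runs forwards in
      \<open>rev r\<close>; it is extended there and the result is reversed back.\<close>
    then have "rev r = rev b @ (w # p) @ rev a" by simp
    then obtain a' b' where
      "rev r = a' @ (v # w # p) @ b' \<or> rev r = a' @ rev (v # w # p) @ b'"
      using step[of "rev r" "rev b" "rev a"] e 3(5) by (metis distinct_rev set_rev walk_edges_rev)
    then have "r = rev b' @ rev (v # w # p) @ rev a' \<or> r = rev b' @ (v # w # p) @ rev a'"
      by (metis append_assoc rev_append rev_rev_ident)
    then show ?thesis by blast
  qed
qed simp

text \<open>Consecutive edges of \<open>p\<close> share a vertex and different routes share none, so
  all edges of \<open>p\<close> come from one route.\<close>

lemma contiguous_in_plan: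
  assumes R: "route_plan I R" and p: "p \<noteq> []" "distinct p" "set p \<subseteq> customers I"
    and e: "\<forall>e\<in>set (walk_edges p). \<exists>r\<in>R. e \<in> set (walk_edges r)"
  shows "\<exists>r\<in>R. \<exists>a b. r = a @ p @ b \<or> r = a @ rev p @ b"
proof -
  note RD = route_planD[OF R]
  have "\<exists>r\<in>R. hd p \<in> set r \<and> set (walk_edges p) \<subseteq> set (walk_edges r)"
    using p e
  proof (induction p rule: induct_list012)
    case (2 v)
    then show ?case using RD(3) by auto
  next
    case (3 v w p)
    then obtain r where r: "r \<in> R" "w \<in> set r" "set (walk_edges (w # p)) \<subseteq> set (walk_edges r)"
      by auto
    obtain r' where r': "r' \<in> R" "{v, w} \<in> set (walk_edges r')" using 3 by auto
    then have "v \<in> set r'" "w \<in> set r'" by (auto dest: in_walk_edges_subset)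
    moreover from this have "r' = r" using RD(4)[OF r(1) r'(1)] r(2) by blast
    ultimately show ?case using r r' by auto
  qed simp
  then show ?thesis
    using contiguous_of_walk_edges[OF p(1,2)] RD(5) by metis
qed

section \<open>A tight solution from marginal recourse costs\<close>

text \<open>\<open>recourse\<close> is unspecified on the empty list; prefixes may be empty, so the value is set
  to \<open>0\<close> there.\<close>

definition prefix_recourse :: "'w vrpsd \<Rightarrow> nat list \<Rightarrow> real" where
  "prefix_recourse I p = (if p = [] then 0 else recourse I p)"

definition recourse_increment :: "'w vrpsd \<Rightarrow> nat list \<Rightarrow> nat \<Rightarrow> real" where
  "recourse_increment I r i =
     (let a = takeWhile (\<lambda>j. j \<noteq> i) r in prefix_recourse I (a @ [i]) - prefix_recourse I a)"

text \<open>A telescoping sum. Customers are removed from the right end of \<open>q\<close> and pass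
  to \<open>b\<close>, which therefore stays arbitrary while the route itself is unchanged.\<close>

lemma sum_recourse_increment:
  assumes "distinct (a @ q @ b)"
  shows "(\<Sum>i\<in>set q. recourse_increment I (a @ q @ b) i) =
           prefix_recourse I (a @ q) - prefix_recourse I a"
  using assms
proof (induction q arbitrary: b rule: rev_induct)
  case (snoc v q)
  have "takeWhile (\<lambda>j. j \<noteq> v) (a @ q @ v # b) = a @ q"
  proof -
    have "\<forall>j\<in>set (a @ q). j \<noteq> v" using snoc.prems by auto
    then have "takeWhile (\<lambda>j. j \<noteq> v) ((a @ q) @ v # b) = (a @ q) @ takeWhile (\<lambda>j. j \<noteq> v) (v # b)"
      by (intro takeWhile_append2) auto
    then show ?thesis by simp
  qed
  then have "recourse_increment I (a @ q @ v # b) v =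
      prefix_recourse I (a @ q @ [v]) - prefix_recourse I (a @ q)"
    by (simp add: recourse_increment_def)
  then show ?case using snoc.IH[of "v # b"] snoc.prems by simp
qed simp

text \<open>If a part is empty, its value 0 gives equality; otherwise both parts inherit feasibility
  and superadditivity applies.\<close>

lemma prefix_recourse_superadditive:
  assumes "superadditive I" "vrpsd_instance I" "p @ q \<in> feasible_paths I"
  shows "prefix_recourse I p + prefix_recourse I q \<le> prefix_recourse I (p @ q)"
proof -
  have "distinct (p @ q)" using assms(3) by (simp add: feasible_paths_def is_path_def)
  then have "p \<noteq> [] \<Longrightarrow> p \<in> feasible_paths I" "q \<noteq> [] \<Longrightarrow> q \<in> feasible_paths I"
    using feasible_paths_mono[OF assms(2,3)] by auto
  then show ?thesis
    using assms(1,3) by (auto simp: prefix_recourse_def superadditive_def)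
qed

lemma recourse_le_sum_increment:
  assumes "superadditive I" "vrpsd_instance I" "a @ q @ b \<in> feasible_paths I" "q \<noteq> []"
  shows "recourse I q \<le> (\<Sum>i\<in>set q. recourse_increment I (a @ q @ b) i)"
proof -
  have d: "distinct (a @ q @ b)" using assms(3) by (simp add: feasible_paths_def is_path_def)
  then have "a @ q \<in> feasible_paths I"
    using feasible_paths_mono[OF assms(2,3), of "a @ q"] assms(4) by auto
  then show ?thesis
    using prefix_recourse_superadditive[OF assms(1,2), of a q] assms(4)
    by (simp add: sum_recourse_increment[OF d]) (simp add: prefix_recourse_def)
qed

lemma exists_tight_solution:
  assumes I: "vrpsd_instance I" and sup: "superadditive I" and R: "route_plan I R"
  obtains \<theta> where "\<forall>i\<in>customers I. 0 \<le> \<theta> i"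
    "\<forall>p\<in>feasible_paths I. p_cut I p (edge_vector R) \<theta>"
    "(\<Sum>i\<in>customers I. \<theta> i) = (\<Sum>p\<in>R. recourse I p)"
proof -
  note RD = route_planD[OF R]
  \<comment> \<open>Each customer lies on exactly one route of \<open>R\<close>. The increments
    refer to the direction in which \<open>R\<close> lists that route.\<close>
  define \<theta> where "\<theta> i = recourse_increment I (THE r. r \<in> R \<and> i \<in> set r) i" for i
  have \<theta>: "\<theta> i = recourse_increment I r i" if "r \<in> R" "i \<in> set r" for r i
  proof -
    have "(THE r. r \<in> R \<and> i \<in> set r) = r"
      using that RD(4) by (intro the_equality) blast+
    then show ?thesis by (simp add: \<theta>_def)
  qed
  have seg: "recourse I q \<le> (\<Sum>i\<in>set q. \<theta> i)" if "r \<in> R" "r = a @ q @ b" "q \<noteq> []" for r a q b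
  proof -
    have "(\<Sum>i\<in>set q. \<theta> i) = (\<Sum>i\<in>set q. recourse_increment I (a @ q @ b) i)"
      using that \<theta>[OF that(1)] by (intro sum.cong) auto
    then show ?thesis
      using recourse_le_sum_increment[OF sup I, of a q b] RD(2) that by metis
  qed
  have nonneg: "\<forall>i\<in>customers I. 0 \<le> \<theta> i"
  proof
    fix i assume "i \<in> customers I"
    then obtain r where r: "r \<in> R" "i \<in> set r" using RD(3) by blast
    \<comment> \<open>A single customer is also a contiguous part of its route, so its increment
      dominates the non-negative recourse of \<open>[i]\<close>.\<close>
    then obtain a b where ab: "r = a @ [i] @ b" by (auto dest: split_list)
    have "[i] \<in> feasible_paths I"
      using feasible_paths_mono[OF I RD(2)[OF r(1)], of "[i]"] r(2) by simp
    then show "0 \<le> \<theta> i"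
      using seg[OF r(1) ab] recourse_nonneg[OF I, of "[i]"] by simp
  qed
  show ?thesis
  proof
    show "\<forall>i\<in>customers I. 0 \<le> \<theta> i" by (fact nonneg)
    have "(\<Sum>i\<in>customers I. \<theta> i) = (\<Sum>p\<in>R. \<Sum>i\<in>set p. \<theta> i)"
      unfolding RD(3)[symmetric] using RD by (intro sum.UNION_disjoint) auto
    also have "\<dots> = (\<Sum>p\<in>R. recourse I p)"
    proof (rule sum.cong)
      fix p assume p: "p \<in> R"
      \<comment> \<open>The whole route is the part with nothing before it, where the telescoping
        sum starts from the value 0 of the empty prefix.\<close>
      have "(\<Sum>i\<in>set p. \<theta> i) = (\<Sum>i\<in>set p. recourse_increment I ([] @ p @ []) i)"
        using \<theta>[OF p] by (intro sum.cong) auto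
      also have "\<dots> = recourse I p"
        using RD(5,6)[OF p] sum_recourse_increment[of "[]" p "[]" I] by (simp add: prefix_recourse_def)
      finally show "(\<Sum>i\<in>set p. \<theta> i) = recourse I p" .
    qed simp
    finally show "(\<Sum>i\<in>customers I. \<theta> i) = (\<Sum>p\<in>R. recourse I p)" .
    show "\<forall>p\<in>feasible_paths I. p_cut I p (edge_vector R) \<theta>"
    proof
      fix p assume p: "p \<in> feasible_paths I"
      then have pd: "p \<noteq> []" "distinct p" "set p \<subseteq> customers I"
        by (auto simp: feasible_paths_def is_path_def)
      let ?x = "\<Sum>e\<leftarrow>walk_edges p. real (edge_vector R e)"
      have dep: "0 \<notin> e" if "e \<in> set (walk_edges p)" for e
        using that walk_edges_in_complete[OF pd(2)] complete_edges_no_depot[OF pd(3)] by blast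
      have le1: "edge_vector R e \<le> 1" if "e \<in> set (walk_edges p)" for e
        using edge_vector_route_edge[OF R] edge_vector_nonroute_edge[OF R dep[OF that]]
        by (metis le_numeral_extra(4) zero_le)
      have x_sum: "?x = (\<Sum>e\<in>set (walk_edges p). real (edge_vector R e))"
        using distinct_walk_edges[OF pd(2)] by (simp add: sum_list_distinct_conv_sum_set)
      have cardE: "real (card (set (walk_edges p))) = real (length p) - 1"
        using distinct_walk_edges[OF pd(2)] pd(1) by (cases p) (auto simp: distinct_card)
      show "p_cut I p (edge_vector R) \<theta>"
      \<comment> \<open>Either \<open>p\<close> or its reversal is a contiguous part of a route, or
        some edge of \<open>p\<close> has value 0.\<close>
      proof (cases "\<forall>e\<in>set (walk_edges p). \<exists>r\<in>R. e \<in> set (walk_edges r)")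
        case True
        then obtain r a b where r: "r \<in> R" "r = a @ p @ b \<or> r = a @ rev p @ b"
          using contiguous_in_plan[OF R pd] by blast
        then have "recourse I p \<le> (\<Sum>i\<in>set p. \<theta> i)"
          using seg[OF r(1), of a p b] seg[OF r(1), of a "rev p" b] pd(1) by auto
        moreover have "?x = real (length p) - 1"
        proof -
          have "edge_vector R e = 1" if "e \<in> set (walk_edges p)" for e
            using True that edge_vector_route_edge[OF R] by blast
          then show ?thesis by (simp add: x_sum flip: cardE)
        qed
        ultimately show ?thesis using pd by (simp add: p_cut_def distinct_card)
      next
        case False
        then obtain e where e: "e \<in> set (walk_edges p)" "edge_vector R e = 0"
          using edge_vector_nonroute_edge[OF R] dep by blast
        \<comment> \<open>Without the edge of value 0, at most \<open>|N(p)| - 2\<close> edges of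
          value at most 1 remain. The bracket of the P-cut is then at most 0.\<close>
        have "?x = (\<Sum>e'\<in>set (walk_edges p) - {e}. real (edge_vector R e'))"
          unfolding x_sum using e by (simp add: sum.remove)
        also have "\<dots> \<le> (\<Sum>e'\<in>set (walk_edges p) - {e}. 1)"
          using le1 by (intro sum_mono) (simp add: of_nat_le_1_iff)
        also have "\<dots> = real (card (set (walk_edges p))) - 1"
          using e(1) card_Suc_Diff1[OF finite_set e(1)] by simp
        finally have "?x \<le> real (length p) - 2" using cardE by simp
        then have "recourse I p * (?x - real (card (set p)) + 2) \<le> 0"
          using recourse_nonneg[OF I p] pd(2)
          by (intro mult_nonneg_nonpos) (auto simp: distinct_card)
        moreover have "0 \<le> (\<Sum>i\<in>set p. \<theta> i)" using nonneg pd(3) by (intro sum_nonneg) auto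
        ultimately show ?thesis by (simp add: p_cut_def)
      qed
    qed
  qed
qed

section \<open>Validity of MP and of the E-cut\<close>

lemma mp_feasible_lower_bound:
  assumes R: "route_plan I R" and P: "\<forall>p\<in>feasible_paths I. p_cut I p (edge_vector R) \<theta>"
  shows "(\<Sum>p\<in>R. recourse I p) \<le> (\<Sum>i\<in>customers I. \<theta> i)"
proof -
  note RD = route_planD[OF R]
  have "(\<Sum>p\<in>R. recourse I p) \<le> (\<Sum>p\<in>R. \<Sum>i\<in>set p. \<theta> i)"
  proof (rule sum_mono)
    fix p assume p: "p \<in> R"
    show "recourse I p \<le> (\<Sum>i\<in>set p. \<theta> i)"
      using P RD(2,5,6)[OF p] edge_vector_route_edge[OF R p]
        p_cut_traversed[of I p "edge_vector R" \<theta>] by blast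
  qed
  also have "\<dots> = (\<Sum>i\<in>customers I. \<theta> i)"
    unfolding RD(3)[symmetric] using RD by (intro sum.UNION_disjoint[symmetric]) auto
  finally show ?thesis .
qed

lemma mp_valid_if_superadditive:
  assumes "vrpsd_instance I" "superadditive I" "admissible_cuts I D"
  shows "mp_valid I D"
  unfolding mp_valid_def
proof (intro allI impI)
  fix x assume x: "first_stage I x"
  \<comment> \<open>Taking the plan selected by \<open>paths_of\<close> makes
    \<open>total_recourse\<close> the sum over \<open>R\<close> by definition.\<close>
  define R where "R = paths_of I x"
  have "route_plan I R \<and> x = edge_vector R"
    using x unfolding R_def paths_of_def first_stage_def by (rule someI_ex)
  then have R: "route_plan I R" and xR: "x = edge_vector R" by auto
  have tot: "total_recourse I x = (\<Sum>p\<in>R. recourse I p)"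
    by (simp add: total_recourse_def R_def)
  obtain \<theta> where \<theta>: "\<forall>i\<in>customers I. 0 \<le> \<theta> i" "\<forall>p\<in>feasible_paths I. p_cut I p x \<theta>"
    "(\<Sum>i\<in>customers I. \<theta> i) = (\<Sum>p\<in>R. recourse I p)"
    using exists_tight_solution[OF assms(1,2) R] unfolding xR by metis
  then have "mp_feasible I D x \<theta>"
    using x s_cut_holds[OF assms(1) x \<theta>(1,2) assms(3)] by (simp add: mp_feasible_def)
  then show "(\<exists>\<theta>. mp_feasible I D x \<theta> \<and> (\<Sum>i\<in>customers I. \<theta> i) = total_recourse I x) \<and>
    (\<forall>\<theta>. mp_feasible I D x \<theta> \<longrightarrow> total_recourse I x \<le> (\<Sum>i\<in>customers I. \<theta> i))"
    using \<theta>(3) mp_feasible_lower_bound[OF R] unfolding tot by (auto simp: mp_feasible_def xR)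
qed

theorem theorem4:
  fixes I :: "'w vrpsd" and D :: s_cut_data
    and S :: "nat set" and E\<^sub>S :: "nat set set" and m :: nat and L :: real
  assumes "vrpsd_instance I"
    and "superadditive I"
    and "admissible_cuts I D"
    and "S \<noteq> {}" and "S \<subseteq> customers I"
    and "E\<^sub>S \<subseteq> complete_edges S"
    and "1 \<le> m" and "enat m \<le> graph_min_paths I S E\<^sub>S"
    and "0 \<le> L" and "ereal L \<le> graph_min_recourse I S E\<^sub>S m"
  shows "valid_inequality I D (\<lambda>x \<theta>.
    (\<Sum>i\<in>S. \<theta> i) \<ge> L * ((\<Sum>e\<in>E\<^sub>S. real (x e)) - real (card S) + real m + 1))"
  unfolding valid_inequality_def
proof (intro conjI allI impI)
  show "mp_valid I D" using assms by (intro mp_valid_if_superadditive)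
next
  fix x \<theta> assume "mp_feasible I D x \<theta>"
  then show "L * ((\<Sum>e\<in>E\<^sub>S. real (x e)) - real (card S) + real m + 1) \<le> (\<Sum>i\<in>S. \<theta> i)"
    using assms by (intro e_cut_holds[of I]) (auto simp: mp_feasible_def)
qed

end
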